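(* (i) For any positive integer $n$, we have $$\frac1n\sum_{k=0}^{n-1}S_k^{(1)}(x)\in\mathbb{Z}[x(x+1)]$$ and $$\frac{(6,n)}n\sum_{k=0}^{n-1}kS_k^{(1)}(x)\in\mathbb{Z}[x(x+1)],$$ where $(6,n)$ is the greatest common divisor of $6$ and $n$. (ii) Let $p$ be any odd prime. Then $$\frac1p\sum_{k=0}^{p-1}S_k^{(1)}(x)\equiv1-(x^{p-1}-1)\left((x+1)^{p-1}-1\right)\pmod{p\mathbb{Z}_p[x]},$$ where $\mathbb{Z}_p$ is the ring of $p$-adic integers.
   Context: For $n\in\mathbb{N}=\{0,1,2,\ldots\}$, the polynomial $S_n^{(1)}(x)\in\mathbb{Z}[x]$ is defined by $$S_n^{(1)}(x)=\sum_{i=0}^n\sum_{j=0}^n\binom ni\binom nj\binom{i+j}ix^{i+j}.$$ Here $x$ is an indeterminate, and $\mathbb{Z}[x(x+1)]$ denotes the set of polynomials of the form $P(x(x+1))$ with $P(z)\in\mathbb{Z}[z]$. For polynomials $F,G$, the congruence $F\equiv G\pmod{p\mathbb{Z}_p[x]}$ means $F-G\in p\mathbb{Z}_p[x]$. *)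

theory Defs
  imports Complex_Main "HOL-Algebra.QuotRing" "HOL-Algebra.UnivPoly"
    "HOL-Computational_Algebra.Primes" "HOL-Computational_Algebra.Polynomial"
begin

text \<open>\<open>HOL-Algebra.UnivPoly\<close> declares record fields \<open>coeff\<close> and \<open>monom\<close>; the
  qualified names below refer to the type \<open>'a poly\<close>.\<close>

definition S1 :: "nat \<Rightarrow> int poly" where
  "S1 n = (\<Sum>i=0..n. \<Sum>j=0..n.
     Polynomial.monom (int ((n choose i) * (n choose j) * ((i + j) choose i))) (i + j))"

abbreviation rat_poly :: "int poly \<Rightarrow> rat poly" where
  "rat_poly \<equiv> map_poly rat_of_int"

abbreviation X :: "'a::comm_ring_1 poly" where
  "X \<equiv> [:0, 1:]"

definition Z_xx1 :: "rat poly set" where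
  "Z_xx1 = {rat_poly (pcompose P (X * (X + 1))) |P :: int poly. True}"


section \<open>The field of p-adic numbers and the ring of p-adic integers\<close>

definition padic_val :: "nat \<Rightarrow> rat \<Rightarrow> int" where
  "padic_val p q = int (multiplicity (int p) (fst (quotient_of q)))
                 - int (multiplicity (int p) (snd (quotient_of q)))"

definition padic_abs :: "nat \<Rightarrow> rat \<Rightarrow> real" where
  "padic_abs p q = (if q = 0 then 0 else real p powi (- padic_val p q))"

text \<open>\<open>\<rat>\<^sub>p\<close> is the completion of \<open>\<rat>\<close>: Cauchy sequences modulo null sequences.\<close>

definition padic_Cauchy :: "nat \<Rightarrow> (nat \<Rightarrow> rat) set" where
  "padic_Cauchy p = {s. \<forall>e>0. \<exists>N. \<forall>m\<ge>N. \<forall>n\<ge>N. padic_abs p (s m - s n) < e}"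

definition padic_null :: "nat \<Rightarrow> (nat \<Rightarrow> rat) set" where
  "padic_null p = {s. (\<lambda>n. padic_abs p (s n)) \<longlonglongrightarrow> 0}"

definition padic_Cauchy_ring :: "nat \<Rightarrow> (nat \<Rightarrow> rat) ring" where
  "padic_Cauchy_ring p = \<lparr>carrier = padic_Cauchy p,
     monoid.mult = (\<lambda>s t n. s n * t n), one = (\<lambda>_. 1),
     zero = (\<lambda>_. 0), add = (\<lambda>s t n. s n + t n)\<rparr>"

definition Qp :: "nat \<Rightarrow> (nat \<Rightarrow> rat) set ring" where
  "Qp p = padic_Cauchy_ring p Quot padic_null p"

definition padic_of_rat :: "nat \<Rightarrow> rat \<Rightarrow> (nat \<Rightarrow> rat) set" where
  "padic_of_rat p q = padic_null p +>\<^bsub>padic_Cauchy_ring p\<^esub> (\<lambda>_. q)"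

text \<open>The absolute value of a class is the limit of the absolute values along any
  representing Cauchy sequence.\<close>

definition padic_norm :: "nat \<Rightarrow> (nat \<Rightarrow> rat) set \<Rightarrow> real" where
  "padic_norm p x = (THE r. \<forall>s\<in>x. (\<lambda>n. padic_abs p (s n)) \<longlonglongrightarrow> r)"

definition Zp :: "nat \<Rightarrow> (nat \<Rightarrow> rat) set ring" where
  "Zp p = Qp p \<lparr>carrier := {x \<in> carrier (Qp p). padic_norm p x \<le> 1}\<rparr>"

text \<open>\<open>UP R\<close> represents a polynomial over \<open>R\<close> by its coefficient function.\<close>

definition padic_poly_of_rat :: "nat \<Rightarrow> rat poly \<Rightarrow> nat \<Rightarrow> (nat \<Rightarrow> rat) set" where
  "padic_poly_of_rat p F = (\<lambda>i. padic_of_rat p (Polynomial.coeff F i))"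

definition pZp_poly :: "nat \<Rightarrow> (nat \<Rightarrow> (nat \<Rightarrow> rat) set) set" where
  "pZp_poly p = {padic_of_rat p (of_nat p) \<odot>\<^bsub>UP (Zp p)\<^esub> H |H. H \<in> carrier (UP (Zp p))}"

definition cong_mod_pZp :: "nat \<Rightarrow> rat poly \<Rightarrow> rat poly \<Rightarrow> bool" where
  "cong_mod_pZp p F G \<longleftrightarrow> padic_poly_of_rat p (F - G) \<in> pZp_poly p"


section \<open>Well-definedness\<close>

context
  fixes p :: nat
  assumes p: "prime p"
begin

lemma prime_int_p: "prime (int p)" using p by simp

lemma padic_val_Fract:
  assumes "a \<noteq> 0" "b \<noteq> 0"
  shows "padic_val p (Fract a b) = int (multiplicity (int p) a) - int (multiplicity (int p) b)"
proof -
  obtain c d where cd: "quotient_of (Fract a b) = (c, d)" by (cases "quotient_of (Fract a b)")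
  have d: "d > 0" using quotient_of_denom_pos[OF cd] .
  have eq: "Fract a b = Fract c d"
    using quotient_of_div[OF cd] by (simp add: Fract_of_int_quotient)
  hence *: "a * d = c * b" using assms d by (simp add: eq_rat)
  hence c: "c \<noteq> 0" using assms d by auto
  have pe: "prime_elem (int p)" using prime_int_p by simp
  have "multiplicity (int p) a + multiplicity (int p) d = multiplicity (int p) c + multiplicity (int p) b"
    using prime_elem_multiplicity_mult_distrib[OF pe, of a d]
      prime_elem_multiplicity_mult_distrib[OF pe, of c b] assms c d * by simp
  thus ?thesis by (simp add: padic_val_def cd)
qed

lemma padic_abs_nonneg: "padic_abs p q \<ge> 0"
  by (simp add: padic_abs_def)

lemma padic_abs_0 [simp]: "padic_abs p 0 = 0"
  by (simp add: padic_abs_def)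

lemma padic_abs_1 [simp]: "padic_abs p 1 = 1"
  by (simp add: padic_abs_def padic_val_def)

lemma padic_abs_mult: "padic_abs p (x * y) = padic_abs p x * padic_abs p y"
proof (cases "x = 0 \<or> y = 0")
  case False
  obtain a b where x: "x = Fract a b" "b > 0" by (cases x) auto
  obtain c d where y: "y = Fract c d" "d > 0" by (cases y) auto
  have nz: "a \<noteq> 0" "c \<noteq> 0" using False x y by (auto simp: rat_number_collapse)
  have pe: "prime_elem (int p)" using prime_int_p by simp
  have "padic_val p (x * y) = padic_val p x + padic_val p y"
    using x y nz padic_val_Fract[of a b] padic_val_Fract[of c d] padic_val_Fract[of "a * c" "b * d"]
    by (simp add: prime_elem_multiplicity_mult_distrib[OF pe])
  thus ?thesis using False p
    by (simp add: padic_abs_def power_int_add prime_gt_0_nat power_int_diff field_simps power_int_minus)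
qed auto

lemma padic_abs_minus [simp]: "padic_abs p (- q) = padic_abs p q"
proof -
  have "padic_abs p (- 1) = 1" by (simp add: padic_abs_def padic_val_def multiplicity_unit_right)
  thus ?thesis using padic_abs_mult[of "- 1" q] by simp
qed

lemma padic_abs_ultrametric: "padic_abs p (x + y) \<le> max (padic_abs p x) (padic_abs p y)"
proof (cases "x = 0 \<or> y = 0 \<or> x + y = 0")
  case True
  thus ?thesis using padic_abs_nonneg by (auto simp: le_max_iff_disj)
next
  case False
  obtain a b where x: "x = Fract a b" "b > 0" by (cases x) auto
  obtain c d where y: "y = Fract c d" "d > 0" by (cases y) auto
  have nz: "a \<noteq> 0" "c \<noteq> 0" using False x y by (auto simp: rat_number_collapse)
  have s: "x + y = Fract (a * d + c * b) (b * d)" using x y by simp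
  have snz: "a * d + c * b \<noteq> 0" using s False by (auto simp: rat_number_collapse)
  have pe: "prime_elem (int p)" using prime_int_p by simp
  have m: "multiplicity (int p) (a * d + c * b)
      \<ge> min (multiplicity (int p) (a * d)) (multiplicity (int p) (c * b))" (is "_ \<ge> ?m")
  proof (rule multiplicity_geI)
    show "int p ^ ?m dvd a * d + c * b"
      by (intro dvd_add multiplicity_dvd') auto
  qed (use snz prime_int_p in auto)
  have "padic_val p (x + y) \<ge> min (padic_val p x) (padic_val p y)"
    using m x y nz snz s padic_val_Fract[of a b] padic_val_Fract[of c d]
      padic_val_Fract[of "a * d + c * b" "b * d"]
    by (simp add: prime_elem_multiplicity_mult_distrib[OF pe] min_def split: if_splits)
  hence "padic_val p (x + y) \<ge> padic_val p x \<or> padic_val p (x + y) \<ge> padic_val p y" by linarith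
  moreover have "real p \<ge> 1" using p prime_ge_1_nat by force
  ultimately show ?thesis using False
    by (auto simp: padic_abs_def le_max_iff_disj intro!: power_int_increasing)
qed

lemma padic_abs_triangle: "padic_abs p (x + y) \<le> padic_abs p x + padic_abs p y"
  using padic_abs_ultrametric[of x y] padic_abs_nonneg[of x] padic_abs_nonneg[of y] by linarith

lemma padic_abs_diff: "\<bar>padic_abs p x - padic_abs p y\<bar> \<le> padic_abs p (x - y)"
  using padic_abs_triangle[of "x - y" y] padic_abs_triangle[of "y - x" x]
    padic_abs_minus[of "x - y"] by simp

lemma padic_Cauchy_Cauchy:
  assumes "s \<in> padic_Cauchy p"
  shows "Cauchy (\<lambda>n. padic_abs p (s n))"
  unfolding Cauchy_def dist_real_def
  using assms padic_abs_diff unfolding padic_Cauchy_def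
  by (smt (verit, best) mem_Collect_eq)

lemma padic_Cauchy_bounded:
  assumes "s \<in> padic_Cauchy p"
  shows "\<exists>B>0. \<forall>n. padic_abs p (s n) \<le> B"
  using Cauchy_Bseq[OF padic_Cauchy_Cauchy[OF assms]] padic_abs_nonneg
  unfolding Bseq_def by (auto intro: exI)

lemma padic_Cauchy_const: "(\<lambda>_. q) \<in> padic_Cauchy p"
  by (simp add: padic_Cauchy_def)

lemma padic_Cauchy_add:
  assumes "s \<in> padic_Cauchy p" "t \<in> padic_Cauchy p"
  shows "(\<lambda>n. s n + t n) \<in> padic_Cauchy p"
  unfolding padic_Cauchy_def
proof safe
  fix e :: real assume e: "e > 0"
  obtain M where M: "\<And>m n. m \<ge> M \<Longrightarrow> n \<ge> M \<Longrightarrow> padic_abs p (s m - s n) < e"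
    using assms(1) e unfolding padic_Cauchy_def by blast
  obtain N where N: "\<And>m n. m \<ge> N \<Longrightarrow> n \<ge> N \<Longrightarrow> padic_abs p (t m - t n) < e"
    using assms(2) e unfolding padic_Cauchy_def by blast
  have "padic_abs p (s m + t m - (s n + t n)) < e" if "m \<ge> max M N" "n \<ge> max M N" for m n
    using M[of m n] N[of m n] that padic_abs_ultrametric[of "s m - s n" "t m - t n"]
    by (simp add: algebra_simps)
  thus "\<exists>N. \<forall>m\<ge>N. \<forall>n\<ge>N. padic_abs p (s m + t m - (s n + t n)) < e" by blast
qed

lemma padic_Cauchy_mult:
  assumes "s \<in> padic_Cauchy p" "t \<in> padic_Cauchy p"
  shows "(\<lambda>n. s n * t n) \<in> padic_Cauchy p"
  unfolding padic_Cauchy_def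
proof safe
  fix e :: real assume e: "e > 0"
  obtain B where B: "B > 0" "\<And>n. padic_abs p (s n) \<le> B"
    using padic_Cauchy_bounded[OF assms(1)] by blast
  obtain C where C: "C > 0" "\<And>n. padic_abs p (t n) \<le> C"
    using padic_Cauchy_bounded[OF assms(2)] by blast
  obtain M where M: "\<And>m n. m \<ge> M \<Longrightarrow> n \<ge> M \<Longrightarrow> padic_abs p (s m - s n) < e / C"
    using assms(1) divide_pos_pos[OF e C(1)] unfolding padic_Cauchy_def by blast
  obtain N where N: "\<And>m n. m \<ge> N \<Longrightarrow> n \<ge> N \<Longrightarrow> padic_abs p (t m - t n) < e / B"
    using assms(2) divide_pos_pos[OF e B(1)] unfolding padic_Cauchy_def by blast
  have "padic_abs p (s m * t m - s n * t n) < e" if mn: "m \<ge> max M N" "n \<ge> max M N" for m n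
  proof -
    have eq: "s m * t m - s n * t n = s m * (t m - t n) + (s m - s n) * t n"
      by (simp add: algebra_simps)
    have "padic_abs p (s m * (t m - t n)) \<le> B * padic_abs p (t m - t n)"
      unfolding padic_abs_mult by (intro mult_right_mono B padic_abs_nonneg)
    also have "\<dots> < e" using N[of m n] mn B(1) by (simp add: field_simps)
    finally have 1: "padic_abs p (s m * (t m - t n)) < e" .
    have "padic_abs p ((s m - s n) * t n) \<le> padic_abs p (s m - s n) * C"
      unfolding padic_abs_mult by (intro mult_left_mono C padic_abs_nonneg)
    also have "\<dots> < e" using M[of m n] mn C(1) by (simp add: field_simps)
    finally have 2: "padic_abs p ((s m - s n) * t n) < e" .
    show ?thesis unfolding eq
      using 1 2 padic_abs_ultrametric[of "s m * (t m - t n)" "(s m - s n) * t n"] by linarith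
  qed
  thus "\<exists>N. \<forall>m\<ge>N. \<forall>n\<ge>N. padic_abs p (s m * t m - s n * t n) < e" by blast
qed

lemma padic_Cauchy_uminus:
  assumes "s \<in> padic_Cauchy p"
  shows "(\<lambda>n. - s n) \<in> padic_Cauchy p"
  using padic_Cauchy_mult[OF padic_Cauchy_const[of "-1"] assms] by simp

lemma padic_Cauchy_cring: "cring (padic_Cauchy_ring p)"
proof (rule cringI)
  show "abelian_group (padic_Cauchy_ring p)"
  proof (rule abelian_groupI)
    fix s assume "s \<in> carrier (padic_Cauchy_ring p)"
    thus "\<exists>t\<in>carrier (padic_Cauchy_ring p). t \<oplus>\<^bsub>padic_Cauchy_ring p\<^esub> s = \<zero>\<^bsub>padic_Cauchy_ring p\<^esub>"
      using padic_Cauchy_uminus by (auto simp: padic_Cauchy_ring_def intro!: bexI[of _ "\<lambda>n. - s n"])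
  qed (auto simp: padic_Cauchy_ring_def padic_Cauchy_add padic_Cauchy_const algebra_simps)
  show "comm_monoid (padic_Cauchy_ring p)"
    by (rule comm_monoidI)
      (auto simp: padic_Cauchy_ring_def padic_Cauchy_mult padic_Cauchy_const algebra_simps)
qed (auto simp: padic_Cauchy_ring_def algebra_simps)

lemma padic_null_subset: "padic_null p \<subseteq> padic_Cauchy p"
proof
  fix s assume s: "s \<in> padic_null p"
  show "s \<in> padic_Cauchy p" unfolding padic_Cauchy_def
  proof safe
    fix e :: real assume "e > 0"
    then obtain N where N: "\<And>n. n \<ge> N \<Longrightarrow> padic_abs p (s n) < e"
      using s padic_abs_nonneg unfolding padic_null_def LIMSEQ_iff by fastforce
    have "padic_abs p (s m - s n) < e" if "m \<ge> N" "n \<ge> N" for m n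
      using N[of m] N[of n] that padic_abs_ultrametric[of "s m" "- s n"] by simp
    thus "\<exists>N. \<forall>m\<ge>N. \<forall>n\<ge>N. padic_abs p (s m - s n) < e" by blast
  qed
qed

lemma padic_null_add:
  assumes "s \<in> padic_null p" "t \<in> padic_null p"
  shows "(\<lambda>n. s n + t n) \<in> padic_null p"
proof -
  have "(\<lambda>n. padic_abs p (s n) + padic_abs p (t n)) \<longlonglongrightarrow> 0"
    using assms tendsto_add[of _ 0 _ _ 0] by (force simp: padic_null_def)
  thus ?thesis unfolding padic_null_def mem_Collect_eq
    by (rule tendsto_0_le[where K = 1]) (simp add: padic_abs_nonneg padic_abs_triangle)
qed

lemma padic_null_mult:
  assumes "s \<in> padic_null p" "t \<in> padic_Cauchy p"
  shows "(\<lambda>n. s n * t n) \<in> padic_null p"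
proof -
  obtain B where B: "B > 0" "\<And>n. padic_abs p (t n) \<le> B"
    using padic_Cauchy_bounded[OF assms(2)] by blast
  have "(\<lambda>n. padic_abs p (s n)) \<longlonglongrightarrow> 0"
    using assms(1) by (simp add: padic_null_def)
  thus ?thesis unfolding padic_null_def mem_Collect_eq
    by (rule tendsto_0_le[where K = B])
      (auto simp: padic_abs_nonneg padic_abs_mult abs_mult intro!: mult_left_mono B always_eventually)
qed

lemma padic_null_ideal: "ideal (padic_null p) (padic_Cauchy_ring p)"
proof -
  interpret cring "padic_Cauchy_ring p" by (rule padic_Cauchy_cring)
  have neg: "\<ominus>\<^bsub>padic_Cauchy_ring p\<^esub> s = (\<lambda>n. - s n)" if "s \<in> padic_Cauchy p" for s
    using that padic_Cauchy_uminus
    by (intro minus_equality) (auto simp: padic_Cauchy_ring_def)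
  show ?thesis
  proof (rule idealI)
    show "subgroup (padic_null p) (add_monoid (padic_Cauchy_ring p))"
    proof (rule add.subgroupI)
      show "padic_null p \<noteq> {}" by (auto simp: padic_null_def intro: exI[of _ "\<lambda>_. 0"])
      fix s assume s: "s \<in> padic_null p"
      hence "s \<in> padic_Cauchy p" using padic_null_subset by blast
      from neg[OF this] s show "\<ominus>\<^bsub>padic_Cauchy_ring p\<^esub> s \<in> padic_null p"
        by (simp add: padic_null_def)
    qed (use padic_null_subset padic_null_add in \<open>auto simp: padic_Cauchy_ring_def\<close>)
  qed (use padic_null_mult ring_axioms in \<open>auto simp: padic_Cauchy_ring_def mult.commute\<close>)
qed

lemma Qp_cring: "cring (Qp p)"
  unfolding Qp_def by (rule ideal.quotient_is_cring[OF padic_null_ideal padic_Cauchy_cring])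

lemma padic_of_rat_altdef:
  "padic_of_rat p q = {s. (\<lambda>n. s n - q) \<in> padic_null p}"
proof -
  have "\<exists>h\<in>padic_null p. s = (\<lambda>n. h n + q)" if "(\<lambda>n. s n - q) \<in> padic_null p" for s
    using that by (intro bexI[of _ "\<lambda>n. s n - q"]) auto
  thus ?thesis
    by (auto simp: padic_of_rat_def a_r_coset_def r_coset_def padic_Cauchy_ring_def)
qed

lemma padic_norm_of_rat: "padic_norm p (padic_of_rat p q) = padic_abs p q"
proof -
  have lim: "(\<lambda>n. padic_abs p (s n)) \<longlonglongrightarrow> padic_abs p q" if "s \<in> padic_of_rat p q" for s
  proof -
    have "(\<lambda>n. padic_abs p (s n - q)) \<longlonglongrightarrow> 0"
      using that by (simp add: padic_of_rat_altdef padic_null_def)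
    hence "(\<lambda>n. padic_abs p (s n) - padic_abs p q) \<longlonglongrightarrow> 0"
      by (rule tendsto_0_le[where K = 1]) (simp add: padic_abs_nonneg padic_abs_diff)
    thus ?thesis by (simp add: LIM_zero_iff)
  qed
  have "(\<lambda>_. q) \<in> padic_of_rat p q" by (simp add: padic_of_rat_altdef padic_null_def)
  thus ?thesis unfolding padic_norm_def
    using lim by (intro the_equality) (auto intro: LIMSEQ_unique)
qed

lemma padic_of_rat_in_Qp: "padic_of_rat p q \<in> carrier (Qp p)"
  using padic_Cauchy_const
  by (auto simp: Qp_def FactRing_def A_RCOSETS_def' padic_of_rat_def padic_Cauchy_ring_def)

lemma padic_of_rat_in_Zp_iff: "padic_of_rat p q \<in> carrier (Zp p) \<longleftrightarrow> padic_abs p q \<le> 1"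
  by (simp add: Zp_def padic_norm_of_rat padic_of_rat_in_Qp)

lemma padic_of_rat_add:
  "padic_of_rat p (q + r) = padic_of_rat p q \<oplus>\<^bsub>Qp p\<^esub> padic_of_rat p r"
proof -
  interpret ideal "padic_null p" "padic_Cauchy_ring p" by (rule padic_null_ideal)
  have "(\<lambda>_. q) \<in> carrier (padic_Cauchy_ring p)" "(\<lambda>_. r) \<in> carrier (padic_Cauchy_ring p)"
    by (simp_all add: padic_Cauchy_ring_def padic_Cauchy_const)
  from a_rcos_sum[OF this] show ?thesis
    by (simp add: Qp_def FactRing_def padic_of_rat_def) (simp add: padic_Cauchy_ring_def)
qed

lemma padic_of_rat_mult:
  "padic_of_rat p (q * r) = padic_of_rat p q \<otimes>\<^bsub>Qp p\<^esub> padic_of_rat p r"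
proof -
  interpret ideal "padic_null p" "padic_Cauchy_ring p" by (rule padic_null_ideal)
  have "(\<lambda>_. q) \<in> carrier (padic_Cauchy_ring p)" "(\<lambda>_. r) \<in> carrier (padic_Cauchy_ring p)"
    by (simp_all add: padic_Cauchy_ring_def padic_Cauchy_const)
  from rcoset_mult_add[OF this] show ?thesis
    by (simp add: Qp_def FactRing_def padic_of_rat_def) (simp add: padic_Cauchy_ring_def)
qed

lemma padic_of_rat_inj: "inj (padic_of_rat p)"
proof (rule injI)
  fix q r assume "padic_of_rat p q = padic_of_rat p r"
  moreover have "(\<lambda>_. q) \<in> padic_of_rat p q" by (simp add: padic_of_rat_altdef padic_null_def)
  ultimately have "(\<lambda>_. padic_abs p (q - r)) \<longlonglongrightarrow> (0::real)"
    by (simp add: padic_of_rat_altdef padic_null_def)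
  hence "padic_abs p (q - r) = 0" by (simp add: LIMSEQ_const_iff)
  thus "q = r" using p by (auto simp: padic_abs_def split: if_splits)
qed

end

end

theory Submission
  imports Defs
begin

text \<open>Put \<open>z = x(x + 1)\<close>. Since \<open>(u + x(1 + u))(1 + x(1 + u)) = u + z(1 + u)\<^sup>2\<close>, comparing the coefficients
  of \<open>u\<^sup>n\<close> in the \<open>n\<close>-th powers gives \<open>S\<^sub>n = \<Sum>\<^sub>k C(n,k) C(2k,k) z\<^sup>k\<close>. The sum of the first \<open>n\<close> of them is
  \<open>n \<Sum>\<^sub>j C(n-1,j) Cat\<^sub>j z\<^sup>j\<close> with the Catalan numbers \<open>Cat\<^sub>j\<close>, and the second divisibility reduces to
  \<open>j + 2\<close> dividing \<open>6 Cat\<^sub>j\<close>.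

  For \<open>n = p\<close>, let \<open>T\<close> be the mean of the \<open>S\<^sub>k\<close>. The generating function of the Catalan
  numbers, truncated modulo \<open>p\<close>, gives \<open>2zT \<equiv> (1 + 4z)\<^sup>m - 1 - 2z\<^sup>p\<close> with \<open>m = (p + 1)/2\<close>. As
  \<open>1 + 4z = (1 + 2x)\<^sup>2\<close>, the Frobenius congruence evaluates the right-hand side, and \<open>2z\<close> can be cancelled
  because \<open>p\<close> is a prime element of \<open>\<int>[x]\<close> that does not divide it.\<close>

section \<open>Catalan numbers: recurrence and divisibility\<close>

definition catalan :: "nat \<Rightarrow> nat" where
  "catalan j = ((2 * j) choose j) div Suc j"

text \<open>By absorption \<open>Suc j\<close> divides
  \<open>Suc (2 * j) * ((2 * j) choose j)\<close>, and it is coprime to \<open>Suc (2 * j)\<close>;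
  hence the \<open>div\<close> in \<open>catalan\<close> is exact.\<close>

lemma Suc_mult_catalan: "Suc j * catalan j = (2 * j) choose j"
proof -
  have "Suc j dvd Suc (2 * j) * ((2 * j) choose j)"
    using Suc_times_binomial[of j "2 * j"] by (metis dvd_triv_left)
  moreover have "coprime (Suc j) (Suc (2 * j))"
  proof (rule coprimeI)
    fix c assume "c dvd Suc j" "c dvd Suc (2 * j)"
    hence "c dvd 2 * Suc j - Suc (2 * j)" by (intro dvd_diff_nat dvd_mult)
    thus "is_unit c" by simp
  qed
  ultimately have "Suc j dvd (2 * j) choose j"
    by (simp only: coprime_dvd_mult_right_iff)
  thus ?thesis by (simp only: catalan_def dvd_mult_div_cancel)
qed

lemma Suc_double_mult_catalan: "Suc (2 * j) * catalan j = Suc (2 * j) choose j"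
proof -
  have "Suc j * (Suc (2 * j) * catalan j) = Suc j * (Suc (2 * j) choose Suc j)"
    by (simp only: Suc_times_binomial flip: Suc_mult_catalan) (simp only: mult_ac)
  hence "Suc (2 * j) * catalan j = Suc (2 * j) choose Suc j"
    by (simp only: mult_cancel1) simp
  also have "\<dots> = Suc (2 * j) choose j"
    using binomial_symmetric[of j "Suc (2 * j)"] by (simp add: Suc_diff_le)
  finally show ?thesis .
qed

lemma catalan_Suc: "(j + 2) * catalan (Suc j) = (4 * j + 2) * catalan j"
proof -
  have "Suc j * ((j + 2) * catalan (Suc j)) = Suc j * (Suc (Suc (2 * j)) choose Suc j)"
    using Suc_mult_catalan[of "Suc j"] by simp
  also have "\<dots> = Suc (Suc (2 * j)) * (Suc (2 * j) * catalan j)"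
    by (simp only: Suc_times_binomial Suc_double_mult_catalan)
  also have "\<dots> = Suc j * ((4 * j + 2) * catalan j)"
    by (simp add: algebra_simps)
  finally show ?thesis by (simp only: mult_cancel1) simp
qed

text \<open>Write the factor \<open>4 * j + 2\<close> of \<open>catalan_Suc\<close> as
  \<open>4 * (j + 2) - 6\<close> and reduce modulo \<open>j + 2\<close>.\<close>

lemma dvd_6_mult_catalan: "(j + 2) dvd 6 * catalan j"
proof -
  have "4 * (j + 2) * catalan j = (j + 2) * catalan (Suc j) + 6 * catalan j"
    unfolding catalan_Suc by (simp add: algebra_simps)
  moreover have "(j + 2) dvd 4 * (j + 2) * catalan j" by (intro dvd_mult2 dvd_mult dvd_refl)
  ultimately show ?thesis by (simp only: dvd_add_right_iff dvd_triv_left)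
qed

section \<open>Expansion in powers of z = x(x + 1)\<close>

definition xx1 :: "int poly" where "xx1 = X * (X + 1)"

lemma smult_sum_right: "smult c (\<Sum>i\<in>A. f i) = (\<Sum>i\<in>A. smult c (f i))"
  by (induction A rule: infinite_finite_induct) (simp_all add: smult_add_right)

lemma S1_eq: "S1 n = (\<Sum>k\<le>n. smult (int ((n choose k) * ((2 * k) choose k))) (xx1 ^ k))"
proof -
  \<comment> \<open>The computation takes place in Z[x][u]: \<open>U\<close> is u, \<open>V\<close>
    is 1 + u, and \<open>C\<close>, \<open>D\<close> are the constants x and z.\<close>
  define U V where "U = [:0, 1 :: int poly:]" and "V = [:1, 1 :: int poly:]"
  define C D where "C = [:X :: int poly:]" and "D = [:xx1:]"
  have coeff: "Polynomial.coeff (of_nat a * [:c:] ^ l * (V ^ m * U ^ (n - i))) n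
      = smult (int (a * (m choose i))) (c ^ l)" if "i \<le> n" for a c l m i
  proof -
    have "U ^ k = Polynomial.monom 1 k" for k by (simp add: U_def monom_altdef)
    hence "Polynomial.coeff (V ^ m * U ^ (n - i)) n = of_nat (m choose i)"
      using that by (cases "i \<le> m") (simp_all add: mult.commute[of _ "Polynomial.monom _ _"]
          coeff_monom_mult V_def coeff_linear_poly_power coeff_eq_0 degree_linear_power)
    thus ?thesis by (simp add: of_nat_poly poly_const_pow mult.assoc mult.commute)
  qed
  \<comment> \<open>The third binomial is the coefficient of u^i in \<open>V ^ (i + j)\<close>; the
    factor \<open>U ^ (n - i)\<close> shifts it to degree \<open>n\<close>.\<close>
  have "S1 n = (\<Sum>i\<le>n. \<Sum>j\<le>n. Polynomial.coeff
      (of_nat ((n choose i) * (n choose j)) * C ^ (i + j) * (V ^ (i + j) * U ^ (n - i))) n)"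
    unfolding S1_def atMost_atLeast0 C_def
    by (intro sum.cong refl, subst coeff) (auto simp: monom_altdef)
  also have "\<dots> = Polynomial.coeff ((C * V + U) ^ n * (C * V + 1) ^ n) n"
    unfolding binomial_ring[of "C * V"] sum_product coeff_sum
    by (intro sum.cong refl arg_cong2[where f = Polynomial.coeff])
      (simp add: power_mult_distrib power_add mult_ac)
  also have "(C * V + U) ^ n * (C * V + 1) ^ n = (D * V ^ 2 + U) ^ n"
    unfolding power_mult_distrib[symmetric]
    by (simp add: C_def D_def U_def V_def xx1_def power2_eq_square algebra_simps one_pCons)
  also have "Polynomial.coeff \<dots> n = (\<Sum>k\<le>n. Polynomial.coeff
      (of_nat (n choose k) * D ^ k * (V ^ (2 * k) * U ^ (n - k))) n)"
    unfolding binomial_ring coeff_sum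
    by (intro sum.cong refl arg_cong2[where f = Polynomial.coeff])
      (simp add: power_mult_distrib mult_ac flip: power_mult)
  also have "\<dots> = (\<Sum>k\<le>n. smult (int ((n choose k) * ((2 * k) choose k))) (xx1 ^ k))"
    unfolding D_def by (intro sum.cong refl, subst coeff) auto
  finally show ?thesis .
qed

section \<open>Weighted sums and divisibility by n\<close>

text \<open>Sum k C(k,j) = (j+1) C(k,j+1) + j C(k,j) over k by the hockey-stick identity; the
  induction step adds one such term.\<close>

lemma sum_mult_choose:
  "(\<Sum>k<n. k * (k choose j)) = Suc j * (n choose (j + 2)) + j * (n choose Suc j)"
proof (induction n)
  case (Suc n)
  have "Suc j * (n choose Suc j) + j * (n choose j) = n * (n choose j)"
    using Suc_times_binomial[of j n] by (simp add: algebra_simps)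
  thus ?case using Suc by (simp add: algebra_simps)
qed auto

text \<open>The weights 1 and k give the two sums of part (i).\<close>

lemma sum_weighted_S1:
  "(\<Sum>k<n. smult (int (w k)) (S1 k))
    = (\<Sum>j<n. smult (int ((\<Sum>k<n. w k * (k choose j)) * ((2 * j) choose j))) (xx1 ^ j))"
proof -
  have "S1 k = (\<Sum>j<n. smult (int ((k choose j) * ((2 * j) choose j))) (xx1 ^ j))" if "k < n" for k
    unfolding S1_eq using that by (intro sum.mono_neutral_left) auto
  hence "(\<Sum>k<n. smult (int (w k)) (S1 k))
    = (\<Sum>k<n. \<Sum>j<n. smult (int (w k * (k choose j) * ((2 * j) choose j))) (xx1 ^ j))"
    by (intro sum.cong refl) (simp add: smult_sum_right mult_ac)
  also have "\<dots> = (\<Sum>j<n. \<Sum>k<n. smult (int (w k * (k choose j) * ((2 * j) choose j))) (xx1 ^ j))"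
    by (rule sum.swap)
  also have "\<dots> = (\<Sum>j<n. smult (int ((\<Sum>k<n. w k * (k choose j)) * ((2 * j) choose j))) (xx1 ^ j))"
    by (intro sum.cong refl) (simp add: sum_distrib_right flip: smult_sum)
  finally show ?thesis .
qed

lemma sum_S1: "(\<Sum>k<n. S1 k)
    = (\<Sum>j<n. smult (int (n * (((n - 1) choose j) * catalan j))) (xx1 ^ j))"
proof -
  have *: "(\<Sum>k<n. k choose j) * ((2 * j) choose j) = n * (((n - 1) choose j) * catalan j)" if "j < n" for j
  proof -
    have "(\<Sum>k<n. k choose j) = n choose Suc j"
      using sum_choose_upper[of j "n - 1"] that by (cases n) (auto simp: lessThan_Suc_atMost)
    hence "(\<Sum>k<n. k choose j) * ((2 * j) choose j) = Suc j * (n choose Suc j) * catalan j"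
      by (simp only: flip: Suc_mult_catalan) (simp only: mult_ac)
    thus ?thesis by (simp add: binomial_absorption mult_ac del: mult_Suc)
  qed
  have "(\<Sum>k<n. S1 k)
      = (\<Sum>j<n. smult (int ((\<Sum>k<n. k choose j) * ((2 * j) choose j))) (xx1 ^ j))"
    using sum_weighted_S1[of "\<lambda>_. 1" n] by (simp only: of_nat_1 smult_1_left mult_1_left)
  also have "\<dots> = (\<Sum>j<n. smult (int (n * (((n - 1) choose j) * catalan j))) (xx1 ^ j))"
    by (intro sum.cong refl) (simp only: * lessThan_iff)
  finally show ?thesis .
qed

text \<open>Of the two terms from \<open>sum_mult_choose\<close>, absorption makes the second a
  multiple of \<open>n\<close>. The first, \<open>A\<close>, needs a further factor
  \<open>j + 2\<close> to absorb, which \<open>6 * catalan j\<close> supplies.\<close>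

lemma dvd_gcd_6_mult_sum:
  fixes n j :: nat
  shows "n dvd gcd 6 n * ((\<Sum>k<n. k * (k choose j)) * ((2 * j) choose j))"
proof -
  define A where "A = Suc j * (n choose (j + 2)) * ((2 * j) choose j)"
  have B: "j * (n choose Suc j) * ((2 * j) choose j) = n * (j * ((n - 1) choose j) * catalan j)"
    (is "?l = _")
  proof -
    have "?l = j * (Suc j * (n choose Suc j)) * catalan j"
      by (simp only: flip: Suc_mult_catalan) (simp only: mult_ac)
    thus ?thesis unfolding binomial_absorption by (simp only: mult_ac)
  qed
  have "n dvd 6 * A"
  proof -
    obtain c where c: "6 * catalan j = (j + 2) * c" using dvd_6_mult_catalan by blast
    have "6 * A = Suc j * (n choose (j + 2)) * (Suc j * (6 * catalan j))"
      unfolding A_def by (simp only: flip: Suc_mult_catalan)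
    also have "\<dots> = Suc j * Suc j * c * (Suc (Suc j) * (n choose Suc (Suc j)))"
      unfolding c by (simp only: add_2_eq_Suc' mult_ac)
    also have "\<dots> = n * (Suc j * Suc j * c * ((n - 1) choose Suc j))"
      unfolding binomial_absorption by (simp only: mult_ac)
    finally show ?thesis by simp
  qed
  \<comment> \<open>Since \<open>n\<close> divides both \<open>6 * A\<close> and
    \<open>n * A\<close>, the factor 6 can be lowered to \<open>gcd 6 n\<close>.\<close>
  hence "n dvd gcd (6 * A) (n * A)" by simp
  hence "n dvd gcd 6 n * A" by (simp add: gcd_mult_distrib_nat mult.commute)
  thus ?thesis
    unfolding sum_mult_choose add_mult_distrib distrib_left B A_def[symmetric] by simp
qed

section \<open>Membership in Z[x(x + 1)]\<close>

lemma coeff_rat_poly [simp]: "Polynomial.coeff (rat_poly P) i = of_int (Polynomial.coeff P i)"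
  by (simp add: coeff_map_poly)

lemma pcompose_power: "pcompose (P ^ n) Q = pcompose P Q ^ n"
  for P Q :: "'a::comm_ring_1 poly"
  by (induction n) (simp_all add: pcompose_mult pcompose_1)

text \<open>The division by \<open>n\<close> is carried out on the coefficients in z, where it is
  exact; \<open>d\<close> is 1 or \<open>gcd 6 n\<close> in the applications.\<close>

lemma smult_rat_poly_in_Z_xx1:
  fixes n d :: nat
  assumes "n > 0" "\<And>j. j < N \<Longrightarrow> n dvd d * c j"
  shows "smult (of_nat d / of_nat n) (rat_poly (\<Sum>j<N. smult (int (c j)) (xx1 ^ j))) \<in> Z_xx1"
proof -
  define b where "b j = d * c j div n" for j
  define P where "P = (\<Sum>j<N. Polynomial.monom (int (b j)) j)"
  define Q where "Q = (\<Sum>j<N. smult (int (c j)) (xx1 ^ j))"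
  have "pcompose P xx1 = (\<Sum>j<N. smult (int (b j)) (xx1 ^ j))"
    unfolding P_def
    by (simp add: pcompose_sum pcompose_smult monom_altdef pcompose_power pcompose_pCons)
  hence eq: "smult (int n) (pcompose P xx1) = smult (int d) Q"
    using assms(2) unfolding Q_def smult_sum_right
    by (auto simp: smult_sum_right b_def simp flip: of_nat_mult intro!: sum.cong)
  have "of_nat n * rat_of_int (Polynomial.coeff (pcompose P xx1) i)
      = of_nat d * rat_of_int (Polynomial.coeff Q i)" for i
    using arg_cong[OF eq, of "\<lambda>R. rat_of_int (Polynomial.coeff R i)"]
    by (simp only: coeff_smult of_int_mult of_int_of_nat_eq)
  hence "smult (of_nat d / of_nat n) (rat_poly Q) = rat_poly (pcompose P xx1)"
    using assms(1) by (intro poly_eqI) (simp add: field_simps)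
  thus ?thesis unfolding Q_def[symmetric] unfolding Z_xx1_def xx1_def by blast
qed

section \<open>Congruences modulo a prime\<close>

lemma prime_dvd_add_power_diff:
  fixes a b :: "'a::comm_ring_1"
  assumes "prime p"
  shows "of_nat p dvd (a + b) ^ p - (a ^ p + b ^ p)"
proof -
  have p: "p > 0" using assms by (simp add: prime_gt_0_nat)
  have "{..p} = insert 0 (insert p {0<..<p})" using p by auto
  hence "(a + b) ^ p - (a ^ p + b ^ p) = (\<Sum>k\<in>{0<..<p}. of_nat (p choose k) * a ^ k * b ^ (p - k))"
    using p by (simp add: binomial_ring)
  also have "of_nat p dvd \<dots>"
  proof (intro dvd_sum dvd_mult2)
    fix k assume "k \<in> {0<..<p}"
    hence "p dvd p choose k" using assms by (intro dvd_choose_prime) auto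
    thus "of_nat p dvd (of_nat (p choose k) :: 'a)" by (auto elim!: dvdE)
  qed
  finally show ?thesis .
qed

text \<open>Vandermonde gives C(2p-1,p-1) = 1 modulo \<open>p\<close>, and this binomial is (2p-1)
  times the Catalan number. It settles the top index k = p - 1.\<close>

lemma prime_dvd_catalan_add_1:
  assumes "prime p"
  shows "int p dvd int (catalan (p - 1)) + 1"
proof -
  have p: "p > 0" using assms by (simp add: prime_gt_0_nat)
  have "(p + (p - 1)) choose (p - 1) = (\<Sum>k\<le>p-1. (p choose k) * ((p - 1) choose (p - 1 - k)))"
    by (rule vandermonde[symmetric])
  also have "\<dots> = 1 + (\<Sum>k\<in>{0<..<p}. (p choose k) * ((p - 1) choose (p - 1 - k)))"
  proof -
    have "{..p-1} = insert 0 {0<..<p}" using p by auto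
    thus ?thesis by simp
  qed
  finally have "(p + (p - 1)) choose (p - 1)
    = 1 + (\<Sum>k\<in>{0<..<p}. (p choose k) * ((p - 1) choose (p - 1 - k)))" (is "_ = 1 + ?s") .
  moreover have "p dvd ?s"
    using assms by (intro dvd_sum dvd_mult2 dvd_choose_prime) auto
  then obtain t where "?s = p * t" by blast
  moreover have "Suc (2 * (p - 1)) = p + (p - 1)" "int (p + (p - 1)) = 2 * int p - 1"
    using p by auto
  ultimately have "(2 * int p - 1) * int (catalan (p - 1)) = 1 + int p * int t"
    using Suc_double_mult_catalan[of "p - 1"]
    by (metis of_nat_1 of_nat_add of_nat_mult)
  hence "int (catalan (p - 1)) + 1 = int p * (2 * int (catalan (p - 1)) - int t)"
    by (simp add: algebra_simps)
  thus ?thesis by simp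
qed

text \<open>\<open>2 (-1)\<^sup>k catalan k\<close> is the coefficient of \<open>t\<^sup>k\<^sup>+\<^sup>1\<close> in \<open>sqrt (1 + 4t)\<close>; modulo \<open>p\<close>, the exponent
  \<open>1/2\<close> may be replaced by \<open>m\<close>, and \<open>p - 1\<close> choose \<open>k\<close> is \<open>(-1)\<^sup>k\<close>.\<close>

lemma prime_dvd_choose_catalan_diff:
  assumes "prime p" "p + 1 = 2 * m" "k + 1 < p"
  shows "int p dvd 2 * int (((p - 1) choose k) * catalan k) - 4 ^ Suc k * int (m choose Suc k)"
  using assms(3)
proof (induction k)
  case 0
  have "2 * int (((p - 1) choose 0) * catalan 0) - 4 ^ Suc 0 * int (m choose Suc 0) = - 2 * int p"
    using assms(2) by (simp add: catalan_def)
  thus ?case by simp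
next
  case (Suc k)
  \<comment> \<open>Modulo \<open>p\<close> both sequences satisfy (k+2) a(k+1) = -(4k+2) a(k), the
    one for \<open>c\<close> after multiplication by k+1.\<close>
  define c where "c k = 2 * int (((p - 1) choose k) * catalan k)" for k
  define d where "d k = 4 ^ Suc k * int (m choose Suc k)" for k
  \<comment> \<open>Over \<open>int\<close> this also covers \<open>i > n\<close>, where both
    binomials vanish; \<open>m\<close> may well be smaller than \<open>k + 1\<close>.\<close>
  have absorb: "int (Suc i) * int (n choose Suc i) = (int n - int i) * int (n choose i)" for i n
  proof (cases "i \<le> n")
    case True
    thus ?thesis
      using binomial_absorption[of i n] binomial_absorb_comp[of n i]
      by (metis of_nat_diff of_nat_mult)
  qed (simp add: not_le binomial_eq_0)
  have c: "int (k + 1) * int (k + 2) * c (Suc k) = (int p - 1 - int k) * int (4 * k + 2) * c k"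
  proof -
    have "int (k + 1) * int (k + 2) * c (Suc k) = 2 * (int (Suc k) * int ((p - 1) choose Suc k))
        * int ((k + 2) * catalan (Suc k))"
      by (simp only: c_def of_nat_mult Suc_eq_plus1 mult_ac)
    thus ?thesis unfolding absorb catalan_Suc c_def using Suc.prems
      by (simp only: of_nat_mult mult_ac of_nat_diff) simp
  qed
  have d: "int (k + 2) * d (Suc k) = (2 * int p - 2 - 4 * int k) * d k"
  proof -
    have "int (k + 2) * d (Suc k)
        = 4 ^ Suc (Suc k) * (int (Suc (Suc k)) * int (m choose Suc (Suc k)))"
      by (simp only: d_def add_2_eq_Suc' mult_ac)
    also have "\<dots> = (4 * (int m - int (Suc k))) * d k"
      unfolding absorb d_def by (simp only: power_Suc mult_ac)
    also have "4 * (int m - int (Suc k)) = 2 * int p - 2 - 4 * int k"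
      using assms(2) by simp
    finally show ?thesis .
  qed
  have "int (k + 1) * int (k + 2) * (c (Suc k) - d (Suc k))
      = int (k + 1) * int (k + 2) * c (Suc k) - int (k + 1) * (int (k + 2) * d (Suc k))"
    by (simp only: right_diff_distrib mult_ac)
  also have "\<dots> = int p * (int (4 * k + 2) * c k - 2 * int (k + 1) * d k)
      - int (k + 1) * int (4 * k + 2) * (c k - d k)"
    unfolding c d by (simp add: algebra_simps)
  also have "int p dvd \<dots>"
    using Suc.IH Suc.prems by (intro dvd_diff[OF dvd_triv_left dvd_mult]) (simp add: c_def d_def)
  finally have "int p dvd int (k + 1) * int (k + 2) * (c (Suc k) - d (Suc k))" .
  moreover have "\<not> int p dvd int (k + 1)" "\<not> int p dvd int (k + 2)"
    using Suc.prems by (auto simp only: int_dvd_int_iff dest!: dvd_imp_le)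
  ultimately have "int p dvd c (Suc k) - d (Suc k)"
    using assms(1) by (auto simp only: prime_dvd_mult_iff prime_nat_int_transfer)
  thus ?case by (simp only: c_def d_def)
qed

text \<open>The mean with its denominator already cancelled, so that congruences can be proved in
  \<open>int poly\<close>.\<close>

definition S1_mean :: "nat \<Rightarrow> int poly" where
  "S1_mean n = (\<Sum>j<n. smult (int (((n - 1) choose j) * catalan j)) (xx1 ^ j))"

lemma sum_S1_eq_smult: "(\<Sum>k<n. S1 k) = smult (int n) (S1_mean n)"
  by (simp add: sum_S1 S1_mean_def smult_sum_right)

lemma prime_dvd_xx1_mult_S1_mean:
  assumes "prime p" "p + 1 = 2 * m" "odd p"
  shows "of_nat p dvd 2 * xx1 * S1_mean p - ((1 + 4 * xx1) ^ m - 1 - 2 * xx1 ^ p)"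
proof -
  have "p \<ge> 2" using assms(1) by (rule prime_ge_2_nat)
  moreover have "p \<noteq> 2" using assms(3) by auto
  ultimately have p: "p > 2" by simp
  obtain q where q: "p = Suc q" using p by (cases p) auto
  \<comment> \<open>\<open>e k\<close> is the coefficient of z^(k+1) in the difference; the
    exceptional value at \<open>q\<close> comes from the term \<open>2 * xx1 ^ p\<close>.\<close>
  define e where "e k = 2 * int (((p - 1) choose k) * catalan k)
    - (4 ^ Suc k * int (m choose Suc k) - (if k = q then 2 else 0))" for k
  have "int p dvd e k" if "k < p" for k
  proof (cases "k = q")
    case True
    \<comment> \<open>This makes \<open>m choose p\<close> vanish, so only the Catalan term and the
      correction 2 remain.\<close>
    have "m < p" using assms(2) p by simp
    hence "e k = 2 * (int (catalan (p - 1)) + 1)"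
      using True q by (simp add: e_def del: binomial_Suc_Suc)
    thus ?thesis using prime_dvd_catalan_add_1[OF assms(1)] by (metis dvd_mult)
  next
    case False
    thus ?thesis using prime_dvd_choose_catalan_diff[OF assms(1,2), of k] that q
      by (simp add: e_def)
  qed
  hence "of_nat p dvd (\<Sum>k<p. smult (e k) (xx1 ^ Suc k))"
    by (intro dvd_sum) (auto simp: of_nat_poly const_poly_dvd_iff)
  also have "(\<Sum>k<p. smult (e k) (xx1 ^ Suc k))
      = (\<Sum>k<p. 2 * xx1 * smult (int (((p - 1) choose k) * catalan k)) (xx1 ^ k))
        - ((\<Sum>k<p. smult (4 ^ Suc k * int (m choose Suc k)) (xx1 ^ Suc k))
           - (\<Sum>k<p. if k = q then 2 * xx1 ^ p else 0))"
  proof -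
    have "smult (e k) (xx1 ^ Suc k)
      = 2 * xx1 * smult (int (((p - 1) choose k) * catalan k)) (xx1 ^ k)
        - (smult (4 ^ Suc k * int (m choose Suc k)) (xx1 ^ Suc k) - (if k = q then 2 * xx1 ^ p else 0))"
      for k
      by (simp add: e_def q smult_diff_left numeral_poly mult_ac del: binomial_Suc_Suc)
    thus ?thesis by (simp only: sum_subtractf)
  qed
  also have "(\<Sum>k<p. 2 * xx1 * smult (int (((p - 1) choose k) * catalan k)) (xx1 ^ k))
      = 2 * xx1 * S1_mean p"
    by (simp only: S1_mean_def sum_distrib_left)
  also have "(\<Sum>k<p. if k = q then 2 * xx1 ^ p else 0) = 2 * xx1 ^ p"
    by (simp add: q)
  also have "(\<Sum>k<p. smult (4 ^ Suc k * int (m choose Suc k)) (xx1 ^ Suc k)) = (1 + 4 * xx1) ^ m - 1"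
  proof -
    have "(1 + 4 * xx1) ^ m = (\<Sum>k\<le>m. of_nat (m choose k) * (4 * xx1) ^ k)"
      using binomial_ring[of "4 * xx1" 1 m] by (simp add: add.commute)
    also have "\<dots> = (\<Sum>k\<le>p. of_nat (m choose k) * (4 * xx1) ^ k)"
      using assms(2) p by (intro sum.mono_neutral_left) auto
    also have "\<dots> = 1 + (\<Sum>k<p. of_nat (m choose Suc k) * (4 * xx1) ^ Suc k)"
      by (simp add: sum.atMost_shift del: binomial_Suc_Suc power_Suc)
    also have "(\<Sum>k<p. of_nat (m choose Suc k) * (4 * xx1) ^ Suc k)
        = (\<Sum>k<p. smult (4 ^ Suc k * int (m choose Suc k)) (xx1 ^ Suc k))"
      by (intro sum.cong refl) (simp add: of_nat_poly numeral_poly smult_power mult_ac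
          del: binomial_Suc_Suc power_Suc)
    finally show ?thesis by simp
  qed
  finally show ?thesis by (simp only: diff_diff_eq2 diff_add_eq)
qed

lemma prime_dvd_S1_mean_diff:
  assumes "prime p" "odd p"
  shows "of_nat p dvd S1_mean p - (1 - (X ^ (p - 1) - 1) * ((X + 1) ^ (p - 1) - 1))"
    (is "_ dvd _ - ?R")
proof -
  obtain m where m: "p + 1 = 2 * m" using assms(2) by (metis evenE odd_even_add odd_one)
  have p: "p > 0" using assms(1) by (simp add: prime_gt_0_nat)
  define x Y V :: "int poly" where "x = X" and "Y = X ^ p" and "V = (X + 1) ^ p"
  have V: "V = (x + 1) ^ p" and Y: "Y = x ^ p" by (simp_all add: V_def x_def Y_def)
  obtain E1 where "(2 * x + 1) ^ p - ((2 * x) ^ p + 1 ^ p) = of_nat p * E1"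
    using prime_dvd_add_power_diff[OF assms(1)] by (metis dvdE)
  moreover obtain E0 where E0: "2 ^ p - 2 = of_nat p * (E0 :: int poly)"
    using prime_dvd_add_power_diff[OF assms(1), of "1 :: int poly" 1] by (auto elim: dvdE)
  moreover have "(2 * x) ^ p = (2 ^ p - 2) * Y + 2 * Y"
    by (simp add: Y power_mult_distrib algebra_simps)
  ultimately have E1: "(2 * x + 1) ^ p = 1 + 2 * Y + of_nat p * (E1 + E0 * Y)"
    by (simp add: algebra_simps)
  obtain E2 where "(x + 1) ^ p - (x ^ p + 1 ^ p) = of_nat p * E2"
    using prime_dvd_add_power_diff[OF assms(1)] by (metis dvdE)
  hence E2: "V = Y + 1 + of_nat p * E2" by (simp add: V Y algebra_simps)
  obtain E3 where E3: "2 * xx1 * S1_mean p - ((1 + 4 * xx1) ^ m - 1 - 2 * xx1 ^ p) = of_nat p * E3"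
    using prime_dvd_xx1_mult_S1_mean[OF assms(1) m assms(2)] by (metis dvdE)
  have xx1: "xx1 = x * (x + 1)" by (simp add: xx1_def x_def)
  have "1 + 4 * xx1 = (2 * x + 1) ^ 2" by (simp add: xx1 power2_eq_square algebra_simps)
  hence pow: "(1 + 4 * xx1) ^ m = (2 * x + 1) * (2 * x + 1) ^ p"
    using m by (simp flip: power_mult power_Suc)
  \<comment> \<open>Multiplying by x(x + 1) turns the two factors into x^p - x and (x+1)^p - (x+1),
    to which the Frobenius congruences apply.\<close>
  have R: "xx1 * ?R = xx1 - (Y - x) * (V - (x + 1))"
  proof -
    have "Y = x * x ^ (p - 1)" "V = (x + 1) * (x + 1) ^ (p - 1)"
      using p by (simp_all add: V Y power_eq_if)
    thus ?thesis unfolding x_def[symmetric] xx1 by (simp add: algebra_simps)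
  qed
  have "2 * xx1 * (S1_mean p - ?R) = (of_nat p * E3 + (1 + 4 * xx1) ^ m - 1 - 2 * (Y * V)) - 2 * (xx1 * ?R)"
  proof -
    have "xx1 ^ p = Y * V" by (simp only: V Y xx1 power_mult_distrib)
    thus ?thesis using E3 by (simp add: algebra_simps)
  qed
  also have "\<dots> = of_nat p * (E3 + (2 * x + 1) * (E1 + E0 * Y) - 2 * x * E2)"
    unfolding R pow E1 unfolding E2 xx1 by (simp add: algebra_simps)
  finally have "of_nat p dvd 2 * xx1 * (S1_mean p - ?R)" by simp
  moreover have "prime_elem (of_nat p :: int poly)"
    using assms(1) by (simp add: of_nat_poly prime_elem_const_poly_iff)
  \<comment> \<open>The coefficient of x is 2, which an odd prime does not divide.\<close>
  moreover have "\<not> of_nat p dvd 2 * xx1"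
  proof
    assume "of_nat p dvd 2 * xx1"
    hence "int p dvd Polynomial.coeff (2 * xx1) 1"
      by (simp add: of_nat_poly const_poly_dvd_iff)
    also have "2 * xx1 = [:0, 2, 2:]" by (simp add: xx1_def numeral_poly one_pCons)
    finally have "int p dvd int 2" by simp
    hence "p dvd 2" by (simp only: int_dvd_int_iff)
    thus False using assms by (metis primes_dvd_imp_eq two_is_prime_nat even_numeral dvd_refl)
  qed
  ultimately show ?thesis by (simp add: prime_elem_dvd_mult_iff)
qed

section \<open>Passage to the p-adic integers\<close>

lemma rat_poly_mult: "rat_poly (P * Q) = rat_poly P * rat_poly Q"
  by (intro poly_eqI) (simp add: coeff_mult)

lemma rat_poly_add: "rat_poly (P + Q) = rat_poly P + rat_poly Q"
  by (intro poly_eqI) simp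

lemma rat_poly_diff: "rat_poly (P - Q) = rat_poly P - rat_poly Q"
  by (intro poly_eqI) simp

lemma rat_poly_power: "rat_poly (P ^ n) = rat_poly P ^ n"
  by (induction n) (simp_all add: rat_poly_mult)

lemma rat_poly_X: "rat_poly X = X"
  by (simp add: map_poly_pCons)

text \<open>Integers have p-adic absolute value at most 1, so the integral quotient \<open>H\<close>
  maps coefficientwise into Z_p[x].\<close>

lemma cong_mod_pZp_rat_polyI:
  assumes "prime p" "of_nat p dvd F - G"
  shows "cong_mod_pZp p (rat_poly F) (rat_poly G)"
proof -
  obtain H where H: "F - G = of_nat p * H" using assms(2) by blast
  define H' where "H' = padic_poly_of_rat p (rat_poly H)"
  have abs: "padic_abs p (of_int a) \<le> 1" for a
    using assms(1) prime_gt_0_nat[of p]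
    by (auto simp: padic_abs_def padic_val_def power_int_minus inverse_le_1_iff)
  \<comment> \<open>The zero of the quotient ring is the ideal of null sequences; this is what
    bounds the support of \<open>H'\<close>.\<close>
  have zero: "padic_of_rat p 0 = \<zero>\<^bsub>Zp p\<^esub>"
    by (simp add: padic_of_rat_altdef[OF assms(1)] Zp_def Qp_def FactRing_def)
  have H': "H' \<in> up (Zp p)"
    unfolding up_def
  proof safe
    show "H' i \<in> carrier (Zp p)" for i
      by (simp add: H'_def padic_poly_of_rat_def padic_of_rat_in_Zp_iff[OF assms(1)] abs)
    have "bound \<zero>\<^bsub>Zp p\<^esub> (degree H) H'"
      by (rule bound.intro) (simp add: H'_def padic_poly_of_rat_def coeff_eq_0 zero)
    thus "\<exists>n. bound \<zero>\<^bsub>Zp p\<^esub> n H'" ..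
  qed
  have "padic_poly_of_rat p (rat_poly F - rat_poly G)
      = (\<lambda>i. padic_of_rat p (of_nat p) \<otimes>\<^bsub>Zp p\<^esub> H' i)"
    unfolding rat_poly_diff[symmetric] H
    by (simp add: H'_def padic_poly_of_rat_def of_nat_poly Zp_def padic_of_rat_mult[OF assms(1)])
  also have "\<dots> = padic_of_rat p (of_nat p) \<odot>\<^bsub>UP (Zp p)\<^esub> H'"
    using H' abs[of "int p"]
    by (simp add: UP_def padic_of_rat_in_Zp_iff[OF assms(1)])
  finally have "padic_poly_of_rat p (rat_poly F - rat_poly G)
      = padic_of_rat p (of_nat p) \<odot>\<^bsub>UP (Zp p)\<^esub> H'" .
  moreover have "H' \<in> carrier (UP (Zp p))" using H' by (simp add: UP_def)
  ultimately show ?thesis unfolding cong_mod_pZp_def pZp_poly_def by blast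
qed

theorem theorem1p3:
  shows "(\<forall>n::nat. n > 0 \<longrightarrow>
            smult (1 / of_nat n) (rat_poly (\<Sum>k=0..n-1. S1 k)) \<in> Z_xx1 \<and>
            smult (of_nat (gcd 6 n) / of_nat n)
              (rat_poly (\<Sum>k=0..n-1. smult (int k) (S1 k))) \<in> Z_xx1)
       \<and> (\<forall>p::nat. prime p \<and> odd p \<longrightarrow>
            cong_mod_pZp p
              (smult (1 / of_nat p) (rat_poly (\<Sum>k=0..p-1. S1 k)))
              (1 - (X ^ (p - 1) - 1) * ((X + 1) ^ (p - 1) - 1)))"
proof (intro conjI allI impI)
  fix n :: nat assume n: "n > 0"
  hence ivl: "{0..n-1} = {..<n}" by auto
  show "smult (1 / of_nat n) (rat_poly (\<Sum>k=0..n-1. S1 k)) \<in> Z_xx1"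
    unfolding ivl sum_S1 
    using smult_rat_poly_in_Z_xx1[OF n, of n 1 "\<lambda>j. n * (((n - 1) choose j) * catalan j)"]
    by (simp only: of_nat_1 mult_1_left dvd_triv_left)
  show "smult (of_nat (gcd 6 n) / of_nat n)
      (rat_poly (\<Sum>k=0..n-1. smult (int k) (S1 k))) \<in> Z_xx1"
    unfolding ivl sum_weighted_S1
    by (intro smult_rat_poly_in_Z_xx1 n dvd_gcd_6_mult_sum)
next
  fix p :: nat assume p: "prime p \<and> odd p"
  hence "p > 0" by (simp add: prime_gt_0_nat)
  hence ivl: "{0..p-1} = {..<p}" by auto
  have "smult (1 / of_nat p) (rat_poly (\<Sum>k=0..p-1. S1 k)) = rat_poly (S1_mean p)"
    unfolding ivl sum_S1_eq_smult using \<open>p > 0\<close> by (intro poly_eqI) simp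
  \<comment> \<open>The right-hand side comes from an integral polynomial too, so the congruence in
    \<open>int poly\<close> transfers.\<close>
  moreover have "1 - (X ^ (p - 1) - 1) * ((X + 1) ^ (p - 1) - 1)
      = rat_poly (1 - (X ^ (p - 1) - 1) * ((X + 1) ^ (p - 1) - 1))"
    by (simp only: rat_poly_diff rat_poly_mult rat_poly_power rat_poly_add rat_poly_X
        map_poly_1' of_int_1)
  ultimately show "cong_mod_pZp p (smult (1 / of_nat p) (rat_poly (\<Sum>k=0..p-1. S1 k)))
      (1 - (X ^ (p - 1) - 1) * ((X + 1) ^ (p - 1) - 1))"
    using cong_mod_pZp_rat_polyI prime_dvd_S1_mean_diff p by simp
qed

end
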